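(* Let $(X,d)$ and $(Y,d)$ be metric spaces, let $0<s<1$ and $s<t$, let $E\subset X$ be $s$-regular and let $F\subset Y$ be $t$-regular. Suppose that either $E$ is bounded or both $E$ and $F$ are unbounded. Then there is a bilipschitz map $f:E\to f(E)\subset F$.
   Context: $B(x,r)$ denotes the closed ball with center $x$ and radius $r$; $d(E)$ denotes the diameter of $E$. Regular sets: for $0<s<\infty$, a set $E\subset X$ is $s$-regular if it is closed and there exist a Borel (outer) measure $\mu$ on $X$ and a constant $C_E$, $1\le C_E<\infty$, such that $\mu(X\setminus E)=0$ and $$r^s\le \mu(B(x,r))\le C_E r^s\quad\text{for all } x\in E,\ 0<r\le d(E),\ r<\infty.$$ Conventions: regular sets contain at least two points, and closed and bounded subsets of regular sets are compact (equivalently, regular sets are complete). Bilipschitz maps: a map $f:A\to B$ between metric spaces is bilipschitz if it is onto and there is $L>0$ with $d(x,y)/L\le d(f(x),f(y))\le L\,d(x,y)$ for all $x,y\in A$. *)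

theory Defs
  imports "HOL-Analysis.Analysis"
begin

(* The diameter d(E) of an unbounded set is infinite, whereas diameter is real-valued and
   unspecified there; hence the upper bound on r is imposed only for bounded E.
   A Borel outer measure enters only through its values on Borel sets, so it is given by a
   measure on the Borel sigma-algebra. The last two conjuncts are the standing conventions
   on regular sets: at least two points, and closed bounded subsets are compact. *)
definition regular_set :: "real \<Rightarrow> 'a::metric_space set \<Rightarrow> bool" where
  "regular_set s E \<longleftrightarrow>
     0 < s \<and> closed E \<and>
     (\<exists>\<mu> :: 'a measure. \<exists>C::real.
        sets \<mu> = sets borel \<and> 1 \<le> C \<and> emeasure \<mu> (- E) = 0 \<and>
        (\<forall>x\<in>E. \<forall>r::real. 0 < r \<longrightarrow> (bounded E \<longrightarrow> r \<le> diameter E) \<longrightarrow>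
           ennreal (r powr s) \<le> emeasure \<mu> (cball x r) \<and>
           emeasure \<mu> (cball x r) \<le> ennreal (C * r powr s))) \<and>
     (\<exists>x\<in>E. \<exists>y\<in>E. x \<noteq> y) \<and>
     (\<forall>K. K \<subseteq> E \<longrightarrow> closed K \<longrightarrow> bounded K \<longrightarrow> compact K)"

definition bilipschitz_map ::
    "'a::metric_space set \<Rightarrow> 'b::metric_space set \<Rightarrow> ('a \<Rightarrow> 'b) \<Rightarrow> bool" where
  "bilipschitz_map A B f \<longleftrightarrow>
     f ` A = B \<and>
     (\<exists>L>0. \<forall>x\<in>A. \<forall>y\<in>A.
        dist x y / L \<le> dist (f x) (f y) \<and> dist (f x) (f y) \<le> L * dist x y)"

end

(* Since s < 1, a delta-chain in E has diameter at most a constant times delta. Hence, for small eta,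
   a finite A in E of diameter D splits into clusters that are eta D apart and have diameter at most
   theta D, theta comparable to eta; their number is at most a constant times eta powr (-s). As
   t > s, a ball of radius comparable to D in F contains that many points with mutual distances at
   least 5 theta times the radius. Mapping each cluster, by induction on the cardinality, close to
   its own point gives a bilipschitz map of A whose constant does not depend on A. Balls in F being
   compact, Tychonoff's theorem yields a bilipschitz map of all of E. *)
theory Submission
  imports Defs
begin

section \<open>Chains, separated families and clusters\<close>

text \<open>The closure is reflexive at every point of the type, so points outside \<open>A\<close>
  are related to themselves and membership in \<open>A\<close> has to be assumed separately.\<close>

definition chain_rel :: "real \<Rightarrow> 'a::metric_space set \<Rightarrow> ('a \<times> 'a) set" where
  "chain_rel \<delta> A = {(u, v). u \<in> A \<and> v \<in> A \<and> dist u v \<le> \<delta>}\<^sup>*"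

text \<open>The constant is a parameter because the compactness argument needs one constant that
  serves all finite subsets.\<close>

definition bilipschitz_on :: "real \<Rightarrow> 'a::metric_space set \<Rightarrow> ('a \<Rightarrow> 'b::metric_space) \<Rightarrow> bool" where
  "bilipschitz_on L A f \<longleftrightarrow>
    (\<forall>x\<in>A. \<forall>y\<in>A. dist x y / L \<le> dist (f x) (f y) \<and> dist (f x) (f y) \<le> L * dist x y)"

text \<open>A family rather than a set, since its points get assigned to clusters; for positive
  \<open>\<delta>\<close> it is automatically injective.\<close>

definition separated_family :: "real \<Rightarrow> 'i set \<Rightarrow> ('i \<Rightarrow> 'a::metric_space) \<Rightarrow> bool" where
  "separated_family \<delta> I e \<longleftrightarrow> (\<forall>i\<in>I. \<forall>j\<in>I. i \<noteq> j \<longrightarrow> \<delta> \<le> dist (e i) (e j))"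

text \<open>A partition, encoded as the function taking a point to its block:
  \<open>cls z = cls x\<close> on \<open>cls x\<close> makes blocks equal or disjoint. Gaps and
  block sizes are relative to the diameter of \<open>A\<close>, so the same \<open>\<eta>\<close>
  and \<open>\<theta>\<close> serve at every scale.\<close>

definition cluster_map :: "real \<Rightarrow> real \<Rightarrow> 'a::metric_space set \<Rightarrow> ('a \<Rightarrow> 'a set) \<Rightarrow> bool" where
  "cluster_map \<eta> \<theta> A cls \<longleftrightarrow>
    (\<forall>x\<in>A. x \<in> cls x \<and> cls x \<subseteq> A \<and> diameter (cls x) \<le> \<theta> * diameter A \<and> (\<forall>z\<in>cls x. cls z = cls x)) \<and>
    (\<forall>x\<in>A. \<forall>y\<in>A. cls x \<noteq> cls y \<longrightarrow> \<eta> * diameter A \<le> dist x y)"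

section \<open>Volume bounds in regular sets\<close>

lemma regular_set_diameter_pos:
  assumes "regular_set s E" "bounded E"
  shows "0 < diameter E"
proof -
  obtain x y where "x \<in> E" "y \<in> E" "x \<noteq> y" using assms unfolding regular_set_def by auto
  then show ?thesis
    using diameter_bounded_bound[OF assms(2), of x y] zero_less_dist_iff[of x y] by linarith
qed

text \<open>Beyond radius \<open>diameter E\<close>, a ball about a point of \<open>E\<close> gains
  only points of the null set \<open>- E\<close>. Hence the upper bound extends to all positive
  radii, so that enlarged balls need no check against the diameter.\<close>

lemma regular_setE:
  fixes E :: "'a::metric_space set"
  assumes "regular_set s E"
  obtains \<mu> :: "'a measure" and C :: real where
    "sets \<mu> = sets borel" "1 \<le> C"
    "\<And>x r. x \<in> E \<Longrightarrow> 0 < r \<Longrightarrow> (bounded E \<Longrightarrow> r \<le> diameter E) \<Longrightarrow>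
       ennreal (r powr s) \<le> emeasure \<mu> (cball x r)"
    "\<And>x r. x \<in> E \<Longrightarrow> 0 < r \<Longrightarrow> emeasure \<mu> (cball x r) \<le> ennreal (C * r powr s)"
    "emeasure \<mu> (- E) = 0"
proof -
  obtain \<mu> :: "'a measure" and C :: real where
    \<mu>: "sets \<mu> = sets borel" and C: "1 \<le> C" and null: "emeasure \<mu> (- E) = 0"
    and reg: "\<And>x r. x \<in> E \<Longrightarrow> 0 < r \<Longrightarrow> (bounded E \<Longrightarrow> r \<le> diameter E) \<Longrightarrow>
           ennreal (r powr s) \<le> emeasure \<mu> (cball x r) \<and>
           emeasure \<mu> (cball x r) \<le> ennreal (C * r powr s)"
    using assms unfolding regular_set_def by metis
  from assms have s: "0 < s" and E: "closed E"
    unfolding regular_set_def by auto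
  have "emeasure \<mu> (cball x r) \<le> ennreal (C * r powr s)" if x: "x \<in> E" and r: "0 < r" for x r
  proof (cases "bounded E \<and> diameter E < r")
    case True
    then have bE: "bounded E" and less: "diameter E < r" by auto
    have pos: "0 < diameter E" by (rule regular_set_diameter_pos[OF assms bE])
    have "cball x r \<subseteq> cball x (diameter E) \<union> - E"
      using diameter_bounded_bound[OF bE x] by auto
    then have "emeasure \<mu> (cball x r) \<le> emeasure \<mu> (cball x (diameter E) \<union> - E)"
      by (intro emeasure_mono) (use E \<mu> in auto)
    also have "\<dots> \<le> emeasure \<mu> (cball x (diameter E)) + emeasure \<mu> (- E)"
      by (intro emeasure_subadditive) (use E \<mu> in auto)
    also have "\<dots> \<le> ennreal (C * diameter E powr s)"
      using reg[OF x pos] null by simp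
    also have "\<dots> \<le> ennreal (C * r powr s)"
      by (intro ennreal_leI mult_left_mono powr_mono2) (use s pos less C in auto)
    finally show ?thesis .
  next
    case False
    then show ?thesis using reg[OF x r] by auto
  qed
  then show ?thesis using that[OF \<mu> C _ _ null] reg by blast
qed

section \<open>Upper and lower bounds for the number of separated points\<close>

text \<open>Packing: the balls of radius \<open>\<delta> / 3\<close> about the points are disjoint
  and lie in a ball of radius \<open>4 * R / 3\<close>. Comparing measures bounds their number by
  \<open>C\<close> times the \<open>s\<close>-th power of the ratio of the radii.\<close>

lemma card_separated_le:
  fixes E :: "'a::metric_space set"
  assumes "regular_set s E"
  obtains C :: real where "1 \<le> C"
    "\<And>(I :: 'i set) e x R \<delta>. finite I \<Longrightarrow> e ` I \<subseteq> E \<inter> cball x R \<Longrightarrow> x \<in> E \<Longrightarrow> 0 < \<delta> \<Longrightarrow> \<delta> \<le> R \<Longrightarrow>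
       (bounded E \<Longrightarrow> \<delta> \<le> diameter E) \<Longrightarrow> separated_family \<delta> I e \<Longrightarrow>
       real (card I) \<le> C * (4 * R / \<delta>) powr s"
proof -
  from assms have s: "0 < s" unfolding regular_set_def by auto
  obtain \<mu> :: "'a measure" and C :: real where
    \<mu>: "sets \<mu> = sets borel" and C: "1 \<le> C"
    and lower: "\<And>x r. x \<in> E \<Longrightarrow> 0 < r \<Longrightarrow> (bounded E \<Longrightarrow> r \<le> diameter E) \<Longrightarrow>
       ennreal (r powr s) \<le> emeasure \<mu> (cball x r)"
    and upper: "\<And>x r. x \<in> E \<Longrightarrow> 0 < r \<Longrightarrow> emeasure \<mu> (cball x r) \<le> ennreal (C * r powr s)"
    using regular_setE[OF assms] by metis
  show ?thesis
  proof (rule that[OF C])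
    fix I :: "'i set" and e x R \<delta>
    assume I: "finite I" "e ` I \<subseteq> E \<inter> cball x R" and x: "x \<in> E" and \<delta>: "0 < \<delta>" "\<delta> \<le> R"
      and adm: "bounded E \<Longrightarrow> \<delta> \<le> diameter E" and sep: "separated_family \<delta> I e"
    \<comment> \<open>The balls are closed, so radius \<open>\<delta> / 2\<close> could let them
      touch; a third leaves room.\<close>
    have disj: "disjoint_family_on (\<lambda>i. cball (e i) (\<delta> / 3)) I"
      unfolding disjoint_family_on_def
    proof (intro ballI impI)
      fix i j assume "i \<in> I" "j \<in> I" "i \<noteq> j"
      then have "\<delta> \<le> dist (e i) (e j)" using sep by (simp add: separated_family_def)
      then have "\<not> (dist (e i) z \<le> \<delta> / 3 \<and> dist (e j) z \<le> \<delta> / 3)" for z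
        using \<delta> dist_triangle2[of "e i" "e j" z] by linarith
      then show "cball (e i) (\<delta> / 3) \<inter> cball (e j) (\<delta> / 3) = {}" by auto
    qed
    have "ennreal (real (card I) * (\<delta> / 3) powr s) = (\<Sum>i\<in>I. ennreal ((\<delta> / 3) powr s))"
      by (simp add: ennreal_mult ennreal_of_nat_eq_real_of_nat)
    also have "\<dots> \<le> (\<Sum>i\<in>I. emeasure \<mu> (cball (e i) (\<delta> / 3)))"
    proof (intro sum_mono lower)
      show "\<delta> / 3 \<le> diameter E" if "bounded E" using adm[OF that] \<delta> by simp
    qed (use I \<delta> in auto)
    also have "\<dots> = emeasure \<mu> (\<Union>i\<in>I. cball (e i) (\<delta> / 3))"
      by (rule sum_emeasure) (use \<mu> disj I in auto)
    also have "\<dots> \<le> emeasure \<mu> (cball x (4 * R / 3))"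
    proof (intro emeasure_mono UN_least subsetI)
      fix i z assume "i \<in> I" "z \<in> cball (e i) (\<delta> / 3)"
      then have "dist x (e i) \<le> R" "dist (e i) z \<le> \<delta> / 3" using I by auto
      then show "z \<in> cball x (4 * R / 3)" using dist_triangle[of x z "e i"] \<delta> by simp
    qed (use \<mu> in auto)
    also have "\<dots> \<le> ennreal (C * (4 * R / 3) powr s)"
      by (rule upper) (use x \<delta> in auto)
    finally have "real (card I) * (\<delta> / 3) powr s \<le> C * (4 * R / 3) powr s"
      using C by (simp add: ennreal_le_iff)
    moreover have "(4 * R / 3) powr s = (4 * R / \<delta>) powr s * (\<delta> / 3) powr s"
      using \<delta> by (subst powr_mult[symmetric]) auto
    ultimately have "real (card I) * (\<delta> / 3) powr s \<le> (C * (4 * R / \<delta>) powr s) * (\<delta> / 3) powr s"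
      by (simp add: mult.assoc)
    then show "real (card I) \<le> C * (4 * R / \<delta>) powr s" using \<delta> by simp
  qed
qed

text \<open>Greedy choice: as long as the \<open>\<delta>\<close>-balls about the points chosen so
  far have total measure below that of \<open>cball y r\<close>, a further point of \<open>F\<close>
  is available. One index is sent to the prescribed point \<open>y\<close>, so that base points can
  be matched later.\<close>

lemma separated_family_exists:
  fixes F :: "'b::metric_space set"
  assumes "regular_set t F"
  obtains C :: real where "1 \<le> C"
    "\<And>(I :: 'i set) i0 y r \<delta>. finite I \<Longrightarrow> i0 \<in> I \<Longrightarrow> y \<in> F \<Longrightarrow> 0 < r \<Longrightarrow> (bounded F \<Longrightarrow> r \<le> diameter F) \<Longrightarrow>
       0 < \<delta> \<Longrightarrow> real (card I) * C * \<delta> powr t < r powr t \<Longrightarrow>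
       \<exists>e. e i0 = y \<and> e ` I \<subseteq> F \<inter> cball y r \<and> separated_family \<delta> I e"
proof -
  from assms have F: "closed F" unfolding regular_set_def by auto
  obtain \<mu> :: "'b measure" and C :: real where
    \<mu>: "sets \<mu> = sets borel" and C: "1 \<le> C"
    and lower: "\<And>x r. x \<in> F \<Longrightarrow> 0 < r \<Longrightarrow> (bounded F \<Longrightarrow> r \<le> diameter F) \<Longrightarrow>
       ennreal (r powr t) \<le> emeasure \<mu> (cball x r)"
    and upper: "\<And>x r. x \<in> F \<Longrightarrow> 0 < r \<Longrightarrow> emeasure \<mu> (cball x r) \<le> ennreal (C * r powr t)"
    and null: "emeasure \<mu> (- F) = 0"
    using regular_setE[OF assms] by metis
  have new: "\<exists>q\<in>F \<inter> cball y r. \<forall>p\<in>S. \<delta> \<le> dist p q"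
    if S: "finite S" "S \<subseteq> F" and y: "y \<in> F" "0 < r" and adm: "bounded F \<Longrightarrow> r \<le> diameter F"
      and \<delta>: "0 < \<delta>" "real (card S) * C * \<delta> powr t < r powr t" for S y r \<delta>
  proof (rule ccontr)
    assume "\<not> ?thesis"
    \<comment> \<open>Without a new point, the \<open>\<delta>\<close>-balls about \<open>S\<close>
      would cover \<open>cball y r\<close> up to a null set.\<close>
    then have sub: "cball y r \<subseteq> (\<Union>p\<in>S. cball p \<delta>) \<union> - F" by (force simp: not_le)
    have meas: "(\<Union>p\<in>S. cball p \<delta>) \<in> sets \<mu>" using \<mu> S by auto
    have "ennreal (r powr t) \<le> emeasure \<mu> (cball y r)" by (rule lower[OF y adm])
    also have "\<dots> \<le> emeasure \<mu> ((\<Union>p\<in>S. cball p \<delta>) \<union> - F)"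
      by (intro emeasure_mono sub sets.Un meas) (use \<mu> F in auto)
    also have "\<dots> \<le> emeasure \<mu> (\<Union>p\<in>S. cball p \<delta>) + emeasure \<mu> (- F)"
      by (intro emeasure_subadditive meas) (use \<mu> F in auto)
    also have "\<dots> \<le> (\<Sum>p\<in>S. emeasure \<mu> (cball p \<delta>))"
      unfolding null add_0_right
      by (intro emeasure_subadditive_finite) (use \<mu> S in auto)
    also have "\<dots> \<le> (\<Sum>p\<in>S. ennreal (C * \<delta> powr t))"
      by (intro sum_mono upper) (use S \<delta> in auto)
    also have "\<dots> = ennreal (real (card S) * C * \<delta> powr t)"
      using C by (simp add: ennreal_mult ennreal_of_nat_eq_real_of_nat mult.assoc)
    finally show False using \<delta> C by (simp add: ennreal_le_iff)
  qed
  show ?thesis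
  proof (rule that[OF C])
    fix I :: "'i set" and i0 y r \<delta>
    assume I: "finite I" "i0 \<in> I" and y: "y \<in> F" "0 < r" and adm: "bounded F \<Longrightarrow> r \<le> diameter F"
      and \<delta>: "0 < \<delta>" "real (card I) * C * \<delta> powr t < r powr t"
    \<comment> \<open>The index \<open>i0\<close> stays outside \<open>J\<close> and is always
      inserted: \<open>y\<close> is the first point chosen, and the induction runs over the other
      indices.\<close>
    have "J \<subseteq> I \<Longrightarrow> i0 \<notin> J \<Longrightarrow> \<exists>e. e i0 = y \<and> e ` insert i0 J \<subseteq> F \<inter> cball y r \<and>
         (\<forall>i\<in>insert i0 J. \<forall>j\<in>insert i0 J. i \<noteq> j \<longrightarrow> \<delta> \<le> dist (e i) (e j))" if "finite J" for J
      using that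
    proof (induction J)
      case empty
      show ?case by (rule exI[of _ "\<lambda>_. y"]) (use y in auto)
    next
      case (insert k J)
      then have "\<exists>e. e i0 = y \<and> e ` insert i0 J \<subseteq> F \<inter> cball y r \<and>
         (\<forall>i\<in>insert i0 J. \<forall>j\<in>insert i0 J. i \<noteq> j \<longrightarrow> \<delta> \<le> dist (e i) (e j))" by simp
      then obtain e where e: "e i0 = y" "e ` insert i0 J \<subseteq> F \<inter> cball y r"
        "\<And>i j. i \<in> insert i0 J \<Longrightarrow> j \<in> insert i0 J \<Longrightarrow> i \<noteq> j \<Longrightarrow> \<delta> \<le> dist (e i) (e j)" by metis
      have "card (e ` insert i0 J) \<le> card (insert i0 J)"
        by (rule card_image_le) (use insert in auto)
      also have "\<dots> \<le> card I" by (rule card_mono) (use I insert in auto)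
      finally have "real (card (e ` insert i0 J)) * (C * \<delta> powr t) \<le> real (card I) * (C * \<delta> powr t)"
        by (intro mult_right_mono) (use C in auto)
      then have "real (card (e ` insert i0 J)) * C * \<delta> powr t < r powr t"
        using \<delta>(2) by (simp add: mult.assoc)
      moreover have "finite (e ` insert i0 J)" "e ` insert i0 J \<subseteq> F" using e(2) insert.hyps by auto
      ultimately obtain q
        where q: "q \<in> F \<inter> cball y r" "\<And>p. p \<in> e ` insert i0 J \<Longrightarrow> \<delta> \<le> dist p q"
        using new[OF _ _ y adm \<delta>(1), of "e ` insert i0 J"] by metis
      have k: "k \<notin> insert i0 J" using insert by auto
      show ?case
      proof (intro exI[of _ "e(k := q)"] conjI ballI impI)
        fix i j assume ij: "i \<in> insert i0 (insert k J)" "j \<in> insert i0 (insert k J)" "i \<noteq> j"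
        show "\<delta> \<le> dist ((e(k := q)) i) ((e(k := q)) j)"
          using ij e(3)[of i j] q(2)[of "e i"] q(2)[of "e j"]
          by (cases "i = k"; cases "j = k") (auto simp: dist_commute)
      next
        show "(e(k := q)) i0 = y" using k e(1) by auto
        show "(e(k := q)) ` insert i0 (insert k J) \<subseteq> F \<inter> cball y r"
          using k e(2) q(1) by (auto simp: image_subset_iff)
      qed
    qed
    from this[of "I - {i0}"] show "\<exists>e. e i0 = y \<and> e ` I \<subseteq> F \<inter> cball y r \<and> separated_family \<delta> I e"
      using I by (simp add: insert_absorb separated_family_def)
  qed
qed

section \<open>Chains and the decomposition into clusters\<close>

lemma chain_rel_sym: "(u, v) \<in> chain_rel \<delta> A \<Longrightarrow> (v, u) \<in> chain_rel \<delta> A"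
  unfolding chain_rel_def by (rule symD[OF sym_rtrancl]) (auto simp: sym_def dist_commute)

lemma chain_rel_trans:
  "(u, v) \<in> chain_rel \<delta> A \<Longrightarrow> (v, w) \<in> chain_rel \<delta> A \<Longrightarrow> (u, w) \<in> chain_rel \<delta> A"
  unfolding chain_rel_def by (rule rtrancl_trans)

lemma chain_rel_closed: "(u, v) \<in> chain_rel \<delta> A \<Longrightarrow> u \<in> A \<Longrightarrow> v \<in> A"
  unfolding chain_rel_def by (induction rule: rtrancl_induct) auto

text \<open>A discrete intermediate value theorem: along the chain the distance from
  \<open>x\<close> grows by at most \<open>\<delta>\<close> per step, so the first point at distance
  at least \<open>c\<close> overshoots by at most \<open>\<delta>\<close>.\<close>

lemma chain_distance_attained:
  assumes "(x, y) \<in> chain_rel \<delta> A" "x \<in> A"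
    and "0 \<le> \<delta>" "0 \<le> c" "c \<le> dist x y"
  shows "\<exists>p\<in>A. c \<le> dist x p \<and> dist x p \<le> c + \<delta>"
  using assms(1,5) unfolding chain_rel_def
proof (induction rule: rtrancl_induct)
  case base
  then show ?case using assms by (intro bexI[of _ x]) auto
next
  case (step y z)
  show ?case
  proof (cases "c \<le> dist x y")
    case False
    moreover have "dist x z \<le> dist x y + \<delta>" using step.hyps(2) dist_triangle[of x z y] by simp
    ultimately show ?thesis using step by (intro bexI[of _ z]) auto
  qed (rule step.IH)
qed

text \<open>A \<open>\<delta>\<close>-chain spanning a distance \<open>D\<close> contains about \<open>D / \<delta>\<close> points that are \<open>\<delta>\<close>-separated,
  whereas regularity allows only about \<open>(D / \<delta>) powr s\<close> of them.\<close>

lemma chain_dist_le: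
  fixes E :: "'a::metric_space set"
  assumes reg: "regular_set s E" and s: "s < 1"
  obtains K where "1 \<le> K"
    "\<And>A \<delta> x y. A \<subseteq> E \<Longrightarrow> 0 < \<delta> \<Longrightarrow> x \<in> A \<Longrightarrow> y \<in> A \<Longrightarrow>
       (x, y) \<in> chain_rel \<delta> A \<Longrightarrow> dist x y \<le> K * \<delta>"
proof -
  from reg have s0: "0 < s" unfolding regular_set_def by auto
  obtain C where C: "1 \<le> C" and count:
    "\<And>(I :: nat set) e x R \<delta>. finite I \<Longrightarrow> e ` I \<subseteq> E \<inter> cball x R \<Longrightarrow> x \<in> E \<Longrightarrow> 0 < \<delta> \<Longrightarrow> \<delta> \<le> R \<Longrightarrow>
       (bounded E \<Longrightarrow> \<delta> \<le> diameter E) \<Longrightarrow> separated_family \<delta> I e \<Longrightarrow>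
       real (card I) \<le> C * (4 * R / \<delta>) powr s"
    using card_separated_le[OF reg, where ?'i = "nat"] by metis
  \<comment> \<open>\<open>B\<close> and \<open>K\<close> come from solving
    \<open>u / 2 \<le> C * (8 * u) powr s\<close> for \<open>u = D / \<delta>\<close>: it gives
    \<open>u powr (1 - s) \<le> B\<close>, hence \<open>u \<le> K\<close> because
    \<open>s < 1\<close>.\<close>
  define B where "B = 2 * C * 8 powr s"
  have B: "1 \<le> B"
    using C s0 ge_one_powr_ge_zero[of 8 s] mult_mono[of 1 C 1 "8 powr s"] by (simp add: B_def)
  define K where "K = B powr (1 / (1 - s))"
  have K: "1 \<le> K" using B s by (simp add: K_def ge_one_powr_ge_zero)
  have key: "dist x y \<le> K * \<delta>"
    if A: "A \<subseteq> E" and \<delta>: "0 < \<delta>" and x: "x \<in> A" and y: "y \<in> A"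
      and chain: "(x, y) \<in> chain_rel \<delta> A" for A \<delta> x y
  proof (cases "dist x y \<le> \<delta>")
    case True
    also have "\<delta> \<le> K * \<delta>" using K \<delta> by simp
    finally show ?thesis .
  next
    case False
    define D where "D = dist x y"
    have D: "\<delta> < D" using False by (simp add: D_def)
    \<comment> \<open>Points are sought at distances \<open>2 * \<delta> * j\<close> from
      \<open>x\<close>. Each may overshoot by \<open>\<delta>\<close>, so a spacing of
      \<open>2 * \<delta>\<close> still leaves them \<open>\<delta>\<close> apart.\<close>
    define m where "m = nat \<lfloor>D / (2 * \<delta>)\<rfloor>"
    have m_le: "2 * \<delta> * real j \<le> D" if "j \<le> m" for j
    proof -
      have "real j \<le> real m" using that by simp
      also have "\<dots> \<le> D / (2 * \<delta>)" unfolding m_def using \<delta> D by (intro of_nat_floor) simp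
      finally have "real j \<le> D / (2 * \<delta>)" .
      then show ?thesis using \<delta> by (simp add: field_simps)
    qed
    have "\<exists>p. p \<in> A \<and> 2 * \<delta> * real j \<le> dist x p \<and> dist x p \<le> 2 * \<delta> * real j + \<delta>"
      if "j \<le> m" for j
      using chain_distance_attained[OF chain x, of "2 * \<delta> * real j"] m_le[OF that] \<delta>
      unfolding D_def by auto
    then obtain p where p: "\<And>j. j \<le> m \<Longrightarrow> p j \<in> A"
      "\<And>j. j \<le> m \<Longrightarrow> 2 * \<delta> * real j \<le> dist x (p j)"
      "\<And>j. j \<le> m \<Longrightarrow> dist x (p j) \<le> 2 * \<delta> * real j + \<delta>" by metis
    have sep: "\<delta> \<le> dist (p i) (p j)" if "i < j" "j \<le> m" for i j
    proof -
      have "2 * \<delta> * (real i + 1) \<le> 2 * \<delta> * real j"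
        using that \<delta> by (intro mult_left_mono) auto
      moreover have "dist x (p j) \<le> dist x (p i) + dist (p i) (p j)" by (rule dist_triangle)
      ultimately show ?thesis
        using p(2)[of j] p(3)[of i] that by (simp add: algebra_simps)
    qed
    have sep': "\<delta> \<le> dist (p i) (p j)" if "i \<noteq> j" "i \<le> m" "j \<le> m" for i j
      using that sep[of i j] sep[of j i] by (cases "i < j") (auto simp: dist_commute)
    \<comment> \<open>All points lie within \<open>D + \<delta>\<close> of \<open>x\<close>, which
      is below \<open>2 * D\<close>.\<close>
    have "real (card {..m}) \<le> C * (4 * (2 * D) / \<delta>) powr s"
    proof (rule count)
      show "p ` {..m} \<subseteq> E \<inter> cball x (2 * D)"
      proof (intro image_subsetI IntI)
        fix j assume "j \<in> {..m}"
        then show "p j \<in> E" "p j \<in> cball x (2 * D)"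
          using p(1,3)[of j] m_le[of j] A D by auto
      qed
      show "\<delta> \<le> diameter E" if "bounded E"
      proof -
        have "D \<le> diameter E"
          unfolding D_def by (rule diameter_bounded_bound[OF that]) (use A x y in auto)
        then show ?thesis using D by simp
      qed
      show "separated_family \<delta> {..m} p" using sep' by (simp add: separated_family_def)
    qed (use A x \<delta> D in auto)
    \<comment> \<open>The indices start at 0, so there are \<open>m + 1\<close> of them, which makes
      up for the rounding down in \<open>m\<close>.\<close>
    moreover have "D / (2 * \<delta>) \<le> real (card {..m})"
      unfolding m_def using D \<delta> by simp linarith
    ultimately have "D / (2 * \<delta>) \<le> C * (8 * (D / \<delta>)) powr s" by simp
    moreover have "(8 * (D / \<delta>)) powr s = 8 powr s * (D / \<delta>) powr s"
      by (rule powr_mult)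
    ultimately have "D / \<delta> \<le> B * (D / \<delta>) powr s" by (simp add: B_def mult_ac)
    moreover have "D / \<delta> = (D / \<delta>) powr (1 - s) * (D / \<delta>) powr s"
      using D \<delta> by (simp flip: powr_add)
    ultimately have "(D / \<delta>) powr (1 - s) * (D / \<delta>) powr s \<le> B * (D / \<delta>) powr s" by simp
    then have "(D / \<delta>) powr (1 - s) \<le> B" using D \<delta> by simp
    then have "((D / \<delta>) powr (1 - s)) powr (1 / (1 - s)) \<le> K"
      unfolding K_def using s by (intro powr_mono2) auto
    then have "D / \<delta> \<le> K" using s D \<delta> by (simp add: powr_powr)
    then show ?thesis using \<delta> by (simp add: D_def field_simps)
  qed
  show ?thesis by (rule that[OF K key])
qed

lemma diameter_leI:
  assumes "S \<noteq> {}" "\<And>x y. x \<in> S \<Longrightarrow> y \<in> S \<Longrightarrow> dist x y \<le> d"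
  shows "diameter S \<le> d"
  using assms by (auto simp: diameter_def intro!: cSUP_least)

text \<open>The clusters are the chain classes at scale \<open>\<eta> * diameter A\<close>. Their
  diameter is controlled by the bound on chains, and one representative from each gives a separated
  family in a ball of radius \<open>diameter A\<close>, whose size is bounded by packing.\<close>

lemma separated_partition:
  fixes E :: "'a::metric_space set"
  assumes reg: "regular_set s E" and s: "s < 1"
  obtains C K where "1 \<le> C" "1 \<le> K"
    "\<And>A \<eta>. finite A \<Longrightarrow> A \<subseteq> E \<Longrightarrow> 0 < diameter A \<Longrightarrow> 0 < \<eta> \<Longrightarrow> \<eta> \<le> 1 \<Longrightarrow>
      \<exists>cls :: 'a \<Rightarrow> 'a set. real (card (cls ` A)) \<le> C * (4 / \<eta>) powr s \<and> cluster_map \<eta> (K * \<eta>) A cls"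
proof -
  obtain C where C: "1 \<le> C" and count:
    "\<And>(I :: 'a set set) e x R \<delta>. finite I \<Longrightarrow> e ` I \<subseteq> E \<inter> cball x R \<Longrightarrow> x \<in> E \<Longrightarrow> 0 < \<delta> \<Longrightarrow> \<delta> \<le> R \<Longrightarrow>
       (bounded E \<Longrightarrow> \<delta> \<le> diameter E) \<Longrightarrow> separated_family \<delta> I e \<Longrightarrow>
       real (card I) \<le> C * (4 * R / \<delta>) powr s"
    using card_separated_le[OF reg, where ?'i = "'a set"] by metis
  obtain K where K: "1 \<le> K" and chain:
    "\<And>A \<delta> x y. A \<subseteq> E \<Longrightarrow> 0 < \<delta> \<Longrightarrow> x \<in> A \<Longrightarrow> y \<in> A \<Longrightarrow>
       (x, y) \<in> chain_rel \<delta> A \<Longrightarrow> dist x y \<le> K * \<delta>"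
    using chain_dist_le[OF reg s] by metis
  show ?thesis
  proof (rule that[OF C K])
    fix A :: "'a set" and \<eta> :: real
    assume A: "finite A" "A \<subseteq> E" and pos: "0 < diameter A" and \<eta>: "0 < \<eta>" "\<eta> \<le> 1"
    define \<delta> where "\<delta> = \<eta> * diameter A"
    have \<delta>: "0 < \<delta>" "\<delta> \<le> diameter A"
      using pos \<eta> by (auto simp: \<delta>_def mult_le_cancel_right1)
    define cls where "cls x = {z. (x, z) \<in> chain_rel \<delta> A}" for x
    have self: "x \<in> cls x" for x by (simp add: cls_def chain_rel_def)
    have subA: "cls x \<subseteq> A" if "x \<in> A" for x
      using that chain_rel_closed by (auto simp: cls_def)
    have cls_eq: "cls z = cls x" if "z \<in> cls x" for x z
      using that chain_rel_sym[of _ _ \<delta> A] chain_rel_trans[of _ _ \<delta> A] unfolding cls_def by blast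
    have sep: "\<delta> \<le> dist x y" if "x \<in> A" "y \<in> A" "cls x \<noteq> cls y" for x y
    proof (rule ccontr)
      assume "\<not> \<delta> \<le> dist x y"
      \<comment> \<open>Two points closer than \<open>\<delta>\<close> form a chain of one
        step.\<close>
      then have "y \<in> cls x" using that by (auto simp: cls_def chain_rel_def)
      then show False using cls_eq that by blast
    qed
    have bA: "bounded A" using A by (simp add: finite_imp_bounded)
    have diam: "diameter (cls x) \<le> K * \<delta>" if x: "x \<in> A" for x
    proof (rule diameter_leI)
      show "cls x \<noteq> {}" using self by blast
      fix u v assume uv: "u \<in> cls x" "v \<in> cls x"
      then have "v \<in> cls u" using cls_eq by blast
      then show "dist u v \<le> K * \<delta>"
        using uv subA[OF x] by (intro chain[OF A(2) \<delta>(1)]) (auto simp: cls_def)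
    qed
    define rep where "rep P = (SOME x. x \<in> A \<and> cls x = P)" for P
    have rep: "rep P \<in> A" "cls (rep P) = P" if "P \<in> cls ` A" for P
    proof -
      have "\<exists>x. x \<in> A \<and> cls x = P" using that by auto
      then show "rep P \<in> A" "cls (rep P) = P" unfolding rep_def by (metis (mono_tags, lifting) someI_ex)+
    qed
    obtain a where a: "a \<in> A" using pos by (cases "A = {}") auto
    have "real (card (cls ` A)) \<le> C * (4 * diameter A / \<delta>) powr s"
    proof (rule count)
      show "rep ` cls ` A \<subseteq> E \<inter> cball a (diameter A)"
        using rep(1) A(2) diameter_bounded_bound[OF bA a] by (auto simp: subset_iff)
      show "\<delta> \<le> diameter E" if "bounded E"
        using \<delta> diameter_subset[OF A(2) that] by simp
      show "separated_family \<delta> (cls ` A) rep"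
        unfolding separated_family_def
      proof (intro ballI impI)
        fix P Q assume "P \<in> cls ` A" "Q \<in> cls ` A" "P \<noteq> Q"
        then show "\<delta> \<le> dist (rep P) (rep Q)" using rep[of P] rep[of Q] by (intro sep) auto
      qed
    qed (use A a \<delta> in auto)
    then have "real (card (cls ` A)) \<le> C * (4 / \<eta>) powr s"
      using pos by (simp add: \<delta>_def)
    moreover have "cluster_map \<eta> (K * \<eta>) A cls"
      unfolding cluster_map_def
      using self subA cls_eq diam sep by (simp add: \<delta>_def mult.assoc)
    ultimately show "\<exists>cls. real (card (cls ` A)) \<le> C * (4 / \<eta>) powr s \<and> cluster_map \<eta> (K * \<eta>) A cls"
      by blast
  qed
qed

section \<open>Bilipschitz maps of finite sets with a uniform constant\<close>

text \<open>Each cluster is mapped by induction near its own point of a separated family. The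
  constant does not deteriorate: pairs inside a cluster keep the inductive bound, and pairs in
  different clusters are compared directly with the scale \<open>D\<close>, which yields the two
  conditions on \<open>L\<close>. The base point and the ball containing the image belong to the
  conclusion because the gluing uses both.\<close>

lemma finite_bilipschitz_exists:
  fixes E :: "'a::metric_space set" and F :: "'b::metric_space set"
  assumes \<eta>: "0 < \<eta>" and \<theta>: "0 < \<theta>" "\<theta> \<le> 1/2" and l: "0 < l"
    and L: "1 / (\<theta> * l) \<le> L" "4 * l / \<eta> \<le> L"
    and part: "\<And>A. finite A \<Longrightarrow> A \<subseteq> E \<Longrightarrow> 0 < diameter A \<Longrightarrow>
      \<exists>cls :: 'a \<Rightarrow> 'a set. real (card (cls ` A)) \<le> N \<and> cluster_map \<eta> \<theta> A cls"
    and family: "\<And>A (I :: 'a set set) i0 y. finite A \<Longrightarrow> A \<subseteq> E \<Longrightarrow> 0 < diameter A \<Longrightarrow>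
      finite I \<Longrightarrow> i0 \<in> I \<Longrightarrow> real (card I) \<le> N \<Longrightarrow> y \<in> F \<Longrightarrow>
      \<exists>e. e i0 = y \<and> e ` I \<subseteq> F \<inter> cball y (l * diameter A) \<and> separated_family (5 * \<theta> * l * diameter A) I e"
    and A: "finite A" "A \<subseteq> E" "x0 \<in> A" "y0 \<in> F"
  shows "\<exists>f. f x0 = y0 \<and> f ` A \<subseteq> F \<inter> cball y0 (2 * l * diameter A) \<and>
    bilipschitz_on L A f"
  using A
proof (induction "card A" arbitrary: A x0 y0 rule: less_induct)
  case less
  define D where "D = diameter A"
  have bA: "bounded A" using less.prems by (simp add: finite_imp_bounded)
  have le_D: "dist x y \<le> D" if "x \<in> A" "y \<in> A" for x y
    unfolding D_def using diameter_bounded_bound[OF bA] that by auto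
  have L0: "0 < L" using L(1) \<theta> l by (smt (verit) divide_pos_pos mult_pos_pos)
  show ?case
  proof (cases "0 < D")
    case False
    have "x = x0" if "x \<in> A" for x
      using le_D[OF that less.prems(3)] False dist_le_zero_iff[of x x0] by linarith
    then have "A = {x0}" using less.prems(3) by blast
    then show ?thesis using less.prems l by (intro exI[of _ "\<lambda>_. y0"]) (auto simp: bilipschitz_on_def)
  next
    case D: True
    have D': "0 < diameter A" using D by (simp add: D_def)
    obtain cls :: "'a \<Rightarrow> 'a set" where N: "real (card (cls ` A)) \<le> N"
      and cmap: "cluster_map \<eta> \<theta> A cls"
      using part[OF less.prems(1,2) D'] by blast
    have cls: "\<And>x. x \<in> A \<Longrightarrow> x \<in> cls x" "\<And>x. x \<in> A \<Longrightarrow> cls x \<subseteq> A"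
        "\<And>x. x \<in> A \<Longrightarrow> diameter (cls x) \<le> \<theta> * D"
        "\<And>x z. x \<in> A \<Longrightarrow> z \<in> cls x \<Longrightarrow> cls z = cls x"
      and sep: "\<And>x y. x \<in> A \<Longrightarrow> y \<in> A \<Longrightarrow> cls x \<noteq> cls y \<Longrightarrow> \<eta> * D \<le> dist x y"
      using cmap unfolding D_def cluster_map_def by blast+
    obtain e where e: "e (cls x0) = y0" "e ` cls ` A \<subseteq> F \<inter> cball y0 (l * D)"
      "\<And>i j. i \<in> cls ` A \<Longrightarrow> j \<in> cls ` A \<Longrightarrow> i \<noteq> j \<Longrightarrow> 5 * \<theta> * l * D \<le> dist (e i) (e j)"
      using family[OF less.prems(1,2) D', of "cls ` A" "cls x0" y0] less.prems N
      unfolding D_def separated_family_def by (metis finite_imageI imageI)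
    \<comment> \<open>The cluster of \<open>x0\<close> keeps \<open>x0\<close> as its base point, so
      that the glued map sends \<open>x0\<close> to \<open>y0\<close>; elsewhere any point will
      do.\<close>
    define b where "b P = (if x0 \<in> P then x0 else SOME z. z \<in> P)" for P
    have "\<exists>g. g (b P) = e P \<and> g ` P \<subseteq> F \<inter> cball (e P) (2 * l * diameter P) \<and>
      bilipschitz_on L P g"
      if P: "P \<in> cls ` A" for P
    proof (rule less.hyps)
      obtain x where "x \<in> A" "P = cls x" using P by blast
      then have P': "P \<noteq> {}" "P \<subseteq> A" "diameter P \<le> \<theta> * D" using cls(1-3)[of x] by auto
      \<comment> \<open>A cluster has smaller diameter than \<open>A\<close>, hence is a proper
        subset.\<close>
      moreover have "\<theta> * D < D" using \<theta> D by simp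
      ultimately have "P \<subset> A" unfolding D_def by auto
      then show "card P < card A" using less.prems by (intro psubset_card_mono)
      show "finite P" "P \<subseteq> E" using P' less.prems by (auto intro: finite_subset)
      show "b P \<in> P" using P' by (auto simp: b_def some_in_eq)
      show "e P \<in> F" using e P by auto
    qed
    then obtain G where G: "\<And>P. P \<in> cls ` A \<Longrightarrow> G P (b P) = e P"
      "\<And>P. P \<in> cls ` A \<Longrightarrow> G P ` P \<subseteq> F \<inter> cball (e P) (2 * l * diameter P)"
      "\<And>P x y. P \<in> cls ` A \<Longrightarrow> x \<in> P \<Longrightarrow> y \<in> P \<Longrightarrow>
        dist x y / L \<le> dist (G P x) (G P y) \<and> dist (G P x) (G P y) \<le> L * dist x y"
      unfolding bilipschitz_on_def by metis
    define f where "f x = G (cls x) x" for x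
    have f: "f x \<in> F" "dist (e (cls x)) (f x) \<le> 2 * l * \<theta> * D" if x: "x \<in> A" for x
    proof -
      have "f x \<in> F \<inter> cball (e (cls x)) (2 * l * diameter (cls x))"
        unfolding f_def using G(2)[of "cls x"] cls(1)[OF x] x by blast
      moreover have "2 * l * diameter (cls x) \<le> 2 * l * (\<theta> * D)"
        using cls(3)[OF x] l by (intro mult_left_mono) auto
      ultimately show "f x \<in> F" "dist (e (cls x)) (f x) \<le> 2 * l * \<theta> * D"
        by (auto simp: mult.assoc)
    qed
    have ball: "dist y0 (f x) \<le> 2 * l * D" if x: "x \<in> A" for x
    proof -
      \<comment> \<open>Here \<open>\<theta> \<le> 1/2\<close> is used:
        \<open>l * D + 2 * l * \<theta> * D \<le> 2 * l * D\<close>, so the radius in the induction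
        reproduces itself.\<close>
      have "l * D * \<theta> \<le> l * D * (1/2)" using \<theta> l D by (intro mult_left_mono) auto
      moreover have "dist y0 (e (cls x)) \<le> l * D" using e(2) x by (auto simp: image_subset_iff)
      ultimately show ?thesis
        using f(2)[OF x] dist_triangle[of y0 "f x" "e (cls x)"] by (simp add: algebra_simps)
    qed
    have "dist x y / L \<le> dist (f x) (f y) \<and> dist (f x) (f y) \<le> L * dist x y"
      if x: "x \<in> A" and y: "y \<in> A" for x y
    proof (cases "cls x = cls y")
      case True
      then show ?thesis unfolding f_def using G(3)[of "cls x" x y] cls(1) x y by (metis imageI)
    next
      case False
      \<comment> \<open>Of the separation \<open>5 * \<theta> * l * D\<close>, each of the two image
        clusters uses up at most \<open>2 * \<theta> * l * D\<close>.\<close>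
      have "5 * \<theta> * l * D \<le> dist (e (cls x)) (e (cls y))" using e(3) False x y by auto
      also have "\<dots> \<le> dist (e (cls x)) (f x) + dist (f x) (f y) + dist (e (cls y)) (f y)"
        using dist_triangle[of "e (cls x)" "e (cls y)" "f x"] dist_triangle[of "f x" "e (cls y)" "f y"]
        by (simp add: dist_commute)
      finally have low: "\<theta> * l * D \<le> dist (f x) (f y)"
        using f(2)[OF x] f(2)[OF y] by (simp add: algebra_simps)
      have "D \<le> L * (\<theta> * l) * D"
        using L(1) \<theta> l D by (simp add: divide_le_eq mult.commute)
      then have "D / L \<le> \<theta> * l * D" using L0 by (simp add: divide_le_eq mult_ac)
      moreover have "dist x y / L \<le> D / L" using le_D[OF x y] L0 by (simp add: divide_right_mono)
      ultimately have 1: "dist x y / L \<le> dist (f x) (f y)" using low by simp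
      \<comment> \<open>All images lie in one ball of radius \<open>2 * l * D\<close>, while
        \<open>x\<close> and \<open>y\<close> are at least \<open>\<eta> * D\<close> apart.\<close>
      have "dist (f x) (f y) \<le> dist y0 (f x) + dist y0 (f y)" by (rule dist_triangle3)
      also have "\<dots> \<le> 4 * l * D" using ball[OF x] ball[OF y] by simp
      also have "\<dots> \<le> L * \<eta> * D"
        using L(2) \<eta> D by (intro mult_right_mono) (auto simp: divide_le_eq)
      also have "\<dots> \<le> L * dist x y" using sep[OF x y False] L0 by (simp add: mult.assoc)
      finally show ?thesis using 1 by simp
    qed
    moreover have "f x0 = y0"
      unfolding f_def using G(1)[of "cls x0"] cls(1)[OF less.prems(3)] less.prems e(1)
      by (simp add: b_def)
    moreover have "f ` A \<subseteq> F \<inter> cball y0 (2 * l * diameter A)"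
      using f(1) ball by (auto simp: D_def)
    ultimately show ?thesis unfolding bilipschitz_on_def by blast
  qed
qed

section \<open>Passage from finite subsets to \<open>E\<close> by compactness\<close>

text \<open>A map with \<open>f x0 = y0\<close> must send \<open>x\<close> into the compact set
  \<open>F \<inter> cball y0 (L * dist x0 x)\<close>. The product of these sets is compact, and the
  condition for one pair involves two coordinates, hence is closed. Finitely many pairs involve a
  finite subset, so the finite intersection property applies.\<close>

lemma bilipschitz_exists_of_finite:
  fixes E :: "'a::metric_space set" and F :: "'b::metric_space set"
  assumes proper: "\<And>y R. compact (F \<inter> cball y R)" and x0: "x0 \<in> E" and L: "0 < L"
    and fin: "\<And>A. finite A \<Longrightarrow> A \<subseteq> E \<Longrightarrow> x0 \<in> A \<Longrightarrow> \<exists>f. f x0 = y0 \<and> f ` A \<subseteq> F \<and>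
      bilipschitz_on L A f"
  shows "\<exists>f. f ` E \<subseteq> F \<and>
    bilipschitz_on L E f"
proof -
  \<comment> \<open>The product runs over the whole type; a singleton serves as the factor off
    \<open>E\<close>.\<close>
  define B where "B x = (if x \<in> E then F \<inter> cball y0 (L * dist x0 x) else {y0})" for x
  define G where "G p = {f :: 'a \<Rightarrow> 'b. dist (fst p) (snd p) / L \<le> dist (f (fst p)) (f (snd p)) \<and>
    dist (f (fst p)) (f (snd p)) \<le> L * dist (fst p) (snd p)}" for p
  have "compactin (product_topology (\<lambda>_. euclidean) UNIV) (PiE UNIV B)"
    by (subst compactin_PiE) (auto simp: B_def proper)
  then have "compact (PiE UNIV B)" by (simp add: euclidean_product_topology)
  then have "PiE UNIV B \<inter> (\<Inter>p\<in>E \<times> E. G p) \<noteq> {}"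
  proof (rule compact_imp_fip_image)
    show "closed (G p)" for p
      unfolding G_def
      by (intro closed_Collect_conj closed_Collect_le continuous_intros
          continuous_on_product_coordinates)
    fix J :: "('a \<times> 'a) set" assume J: "finite J" "J \<subseteq> E \<times> E"
    \<comment> \<open>\<open>x0\<close> is adjoined because the distance to \<open>f x0 = y0\<close>
      is what puts the values into \<open>B\<close>.\<close>
    define A where "A = insert x0 (fst ` J \<union> snd ` J)"
    have "finite A" "A \<subseteq> E" "x0 \<in> A" using J x0 by (auto simp: A_def)
    then obtain f where f: "f x0 = y0" "f ` A \<subseteq> F"
      "\<And>x y. x \<in> A \<Longrightarrow> y \<in> A \<Longrightarrow> dist x y / L \<le> dist (f x) (f y) \<and> dist (f x) (f y) \<le> L * dist x y"
      using fin[of A] unfolding bilipschitz_on_def by metis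
    \<comment> \<open>The map of \<open>{x0}\<close> shows that \<open>y0\<close> is in
      \<open>F\<close>, hence in every \<open>B x\<close>; it can then be the default value of
      \<open>g\<close> off \<open>A\<close>.\<close>
    obtain f0 where f0: "f0 x0 = y0" "f0 x0 \<in> F" using fin[of "{x0}"] x0 by auto
    define g where "g x = (if x \<in> A then f x else y0)" for x
    have "g x \<in> B x" for x
    proof (cases "x \<in> A")
      case True
      then have "f x \<in> F" "dist (f x0) (f x) \<le> L * dist x0 x" "x \<in> E"
        using f(2) f(3)[OF \<open>x0 \<in> A\<close> True] \<open>A \<subseteq> E\<close> by auto
      then show ?thesis using True f(1) by (simp add: B_def g_def)
    next
      case False
      then show ?thesis using f0 L by (simp add: B_def g_def)
    qed
    then have "g \<in> PiE UNIV B" by (simp add: PiE_iff)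
    moreover have "g \<in> G p" if "p \<in> J" for p
    proof -
      have "fst p \<in> A" "snd p \<in> A" using that by (auto simp: A_def)
      then show ?thesis using f(3) by (simp add: G_def g_def)
    qed
    ultimately show "PiE UNIV B \<inter> (\<Inter>p\<in>J. G p) \<noteq> {}" by blast
  qed
  then obtain f where f: "f \<in> PiE UNIV B" "\<And>x y. x \<in> E \<Longrightarrow> y \<in> E \<Longrightarrow> f \<in> G (x, y)" by blast
  have "f x \<in> F" if "x \<in> E" for x
    using f(1) that by (auto simp: B_def PiE_iff dest: spec[of _ x] split: if_splits)
  then show ?thesis using f(2) by (intro exI[of _ f]) (auto simp: G_def bilipschitz_on_def)
qed

section \<open>Choice of the constants and conclusion\<close>

theorem theorem3p3:
  fixes E :: "'a::metric_space set" and F :: "'b::metric_space set" and s t :: real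
  assumes "0 < s" and "s < 1" and "s < t"
    and "regular_set s E" and "regular_set t F"
    and "bounded E \<or> (\<not> bounded E \<and> \<not> bounded F)"
  shows "\<exists>f :: 'a \<Rightarrow> 'b. bilipschitz_map E (f ` E) f \<and> f ` E \<subseteq> F"
proof -
  obtain C K where CK: "1 \<le> C" "1 \<le> K" and part:
    "\<And>A \<eta>. finite A \<Longrightarrow> A \<subseteq> E \<Longrightarrow> 0 < diameter A \<Longrightarrow> 0 < \<eta> \<Longrightarrow> \<eta> \<le> 1 \<Longrightarrow>
      \<exists>cls :: 'a \<Rightarrow> 'a set. real (card (cls ` A)) \<le> C * (4 / \<eta>) powr s \<and> cluster_map \<eta> (K * \<eta>) A cls"
    using separated_partition[OF assms(4,2)] by metis
  obtain C' where C': "1 \<le> C'" and family: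
    "\<And>(I :: 'a set set) i0 y r \<delta>. finite I \<Longrightarrow> i0 \<in> I \<Longrightarrow> y \<in> F \<Longrightarrow> 0 < r \<Longrightarrow> (bounded F \<Longrightarrow> r \<le> diameter F) \<Longrightarrow>
       0 < \<delta> \<Longrightarrow> real (card I) * C' * \<delta> powr t < r powr t \<Longrightarrow>
       \<exists>e. e i0 = y \<and> e ` I \<subseteq> F \<inter> cball y r \<and> separated_family \<delta> I e"
    using separated_family_exists[OF assms(5), where ?'i = "'a set"] by metis
  \<comment> \<open>\<open>l\<close> rescales diameters in \<open>E\<close> to admissible radii in
    \<open>F\<close>. This is where the boundedness assumption enters: if \<open>F\<close> is
    bounded, so is \<open>E\<close>, and the ratio of the diameters works.\<close>
  obtain l where l: "0 < l" and adm: "\<And>A. A \<subseteq> E \<Longrightarrow> bounded F \<Longrightarrow> l * diameter A \<le> diameter F"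
  proof (cases "bounded F")
    case True
    then have bE: "bounded E" using assms(6) by auto
    have pos: "0 < diameter F" "0 < diameter E"
      using regular_set_diameter_pos[OF assms(5) True] regular_set_diameter_pos[OF assms(4) bE] by auto
    show ?thesis
    proof (rule that[of "diameter F / diameter E"])
      fix A assume "A \<subseteq> E"
      then have "diameter A \<le> diameter E" using bE by (rule diameter_subset)
      then show "diameter F / diameter E * diameter A \<le> diameter F"
        using pos by (simp add: field_simps)
    qed (use pos in auto)
  qed (use that[of 1] in auto)
  \<comment> \<open>\<open>c\<close> collects the factors independent of \<open>\<eta>\<close> in
    the cluster bound times \<open>C' * (5 * (K * \<eta>)) powr t\<close>; what remains is
    \<open>\<eta> powr (t - s)\<close>.\<close>
  define c where "c = C * C' * 4 powr s * (5 * K) powr t"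
  have c: "0 < c" unfolding c_def using CK C' by simp
  \<comment> \<open>The first term makes the cluster ratio \<open>K * \<eta>\<close> at most
    \<open>1 / 2\<close>; the second makes \<open>c * \<eta> powr (t - s)\<close> at most
    \<open>1 / 2\<close>, which is possible since \<open>s < t\<close>.\<close>
  define \<eta> where "\<eta> = min (1 / (2 * K)) ((1 / (2 * c)) powr (1 / (t - s)))"
  have \<eta>: "0 < \<eta>" unfolding \<eta>_def using CK c by simp
  have "\<eta> \<le> 1 / (2 * K)" unfolding \<eta>_def by simp
  then have \<eta>K: "K * \<eta> \<le> 1 / 2" using CK by (simp add: field_simps)
  have "1 * \<eta> \<le> K * \<eta>" using CK \<eta> by (intro mult_right_mono) auto
  then have \<eta>1: "\<eta> \<le> 1" using \<eta>K by linarith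
  have "\<eta> powr (t - s) \<le> ((1 / (2 * c)) powr (1 / (t - s))) powr (t - s)"
    using \<eta> assms(3) by (intro powr_mono2) (auto simp: \<eta>_def)
  also have "\<dots> = 1 / (2 * c)" using assms(3) c by (simp add: powr_powr)
  finally have "c * \<eta> powr (t - s) \<le> 1 / 2" using c by (simp add: field_simps)
  moreover have "c * \<eta> powr (t - s) = C * (4 / \<eta>) powr s * C' * (5 * (K * \<eta>)) powr t"
    unfolding c_def using \<eta> CK by (simp add: powr_diff powr_divide powr_mult field_simps)
  ultimately have small: "C * (4 / \<eta>) powr s * C' * (5 * (K * \<eta>)) powr t < 1" by simp
  obtain x0 where x0: "x0 \<in> E" using assms(4) unfolding regular_set_def by auto
  obtain y0 where y0: "y0 \<in> F" using assms(5) unfolding regular_set_def by auto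
  define L where "L = max (1 / (K * \<eta> * l)) (4 * l / \<eta>)"
  have L: "0 < L" unfolding L_def using l \<eta> by (simp add: less_max_iff_disj)
  have proper: "compact (F \<inter> cball y R)" for y R
    using assms(5) unfolding regular_set_def
    by (meson Int_lower1 Int_lower2 bounded_cball bounded_subset closed_Int closed_cball)
  have "\<exists>f. f ` E \<subseteq> F \<and>
    bilipschitz_on L E f"
  proof (rule bilipschitz_exists_of_finite[OF proper x0 L])
    fix A assume A: "finite A" "A \<subseteq> E" "x0 \<in> A"
    have "\<exists>f. f x0 = y0 \<and> f ` A \<subseteq> F \<inter> cball y0 (2 * l * diameter A) \<and>
      bilipschitz_on L A f"
    proof (rule finite_bilipschitz_exists[where E = E and \<eta> = \<eta> and \<theta> = "K * \<eta>"
          and N = "C * (4 / \<eta>) powr s"])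
      fix A :: "'a set" and I :: "'a set set" and i0 y
      assume A: "finite A" "A \<subseteq> E" "0 < diameter A"
        and I: "finite I" "i0 \<in> I" "real (card I) \<le> C * (4 / \<eta>) powr s" and y: "y \<in> F"
      have r: "0 < l * diameter A" using l A by simp
      have "real (card I) * (C' * (5 * (K * \<eta>)) powr t) \<le> C * (4 / \<eta>) powr s * (C' * (5 * (K * \<eta>)) powr t)"
        using I C' by (intro mult_right_mono) auto
      then have "real (card I) * C' * (5 * (K * \<eta>)) powr t < 1" using small by (simp add: mult.assoc)
      \<comment> \<open>The counting condition is scale invariant: it is checked at radius 1 and
        multiplied by the \<open>t\<close>-th power of the actual radius.\<close>
      then have "real (card I) * C' * (5 * (K * \<eta>)) powr t * (l * diameter A) powr t < 1 * (l * diameter A) powr t"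
        using r by (intro mult_strict_right_mono) auto
      then have "real (card I) * C' * (5 * (K * \<eta>) * l * diameter A) powr t < (l * diameter A) powr t"
        using r CK \<eta> l A by (simp add: powr_mult mult_ac)
      then show "\<exists>e. e i0 = y \<and> e ` I \<subseteq> F \<inter> cball y (l * diameter A) \<and> separated_family (5 * (K * \<eta>) * l * diameter A) I e"
        by (intro family[OF I(1,2) y r]) (use adm A CK \<eta> l in auto)
    qed (use \<eta> \<eta>K CK l A y0 part \<eta>1 in \<open>auto simp: L_def\<close>)
    then show "\<exists>f. f x0 = y0 \<and> f ` A \<subseteq> F \<and>
      bilipschitz_on L A f" by blast
  qed
  then show ?thesis unfolding bilipschitz_map_def bilipschitz_on_def using L by blast
qed

end
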